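(* Let $\boldsymbol d_0,\dots,\boldsymbol d_n\in\mathbb N_0^3$ be fixed multidegrees, where $n=n_x+n_y+n_z$. Let $\theta\in\mathcal A(\boldsymbol d_0)$ and let $M=\begin{bmatrix} M_{1,1} & M_{1,2} \\ M_{2,1} & M_{2,2} \end{bmatrix}$ be a square matrix with entries in $\mathbb K[\boldsymbol u]$ having property $\Pi_\theta(\boldsymbol d_0,\dots,\boldsymbol d_n)$. Let $\boldsymbol{f_0}=(f_0,f_1,\dots,f_n)\in S(\boldsymbol d_0)\times\dots\times S(\boldsymbol d_n)$ be a system such that the specialization $M_{1,1}(\boldsymbol{f_0})$ is non-singular. Then, for every $\alpha\in V_{\mathcal P}(f_1,\dots,f_n)$ such that $\boldsymbol w^\theta(\alpha)\ne 0$, the value $\frac{f_0}{\boldsymbol w^\theta}(\alpha)$ is an eigenvalue of the Schur complement of $M_{2,2}(\boldsymbol{f_0})$, i.e. of the matrix $$M_{2,2}(\boldsymbol{f_0})-M_{2,1}(\boldsymbol{f_0})\cdot M_{1,1}(\boldsymbol{f_0})^{-1}\cdot M_{1,2}(\boldsymbol{f_0}).$$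
   Context: $\mathbb K$ is an algebraically closed field of characteristic $0$, $n_x,n_y,n_z\ge1$ are integers, $n=n_x+n_y+n_z$, and $\mathcal P=\mathbb P^{n_x}\times\mathbb P^{n_y}\times\mathbb P^{n_z}$ over $\mathbb K$, with blocks of homogeneous coordinates $\boldsymbol x,\boldsymbol y,\boldsymbol z$. For $\boldsymbol d=(d_x,d_y,d_z)\in\mathbb N_0^3$, $S(\boldsymbol d)$ is the space of multihomogeneous polynomials of degrees $d_x,d_y,d_z$ in $\boldsymbol x,\boldsymbol y,\boldsymbol z$; $\mathcal A(\boldsymbol d)$ is the set of exponents $\sigma=(\sigma_x,\sigma_y,\sigma_z)$ of monomials of multidegree $\boldsymbol d$, and $\boldsymbol w^\sigma=\boldsymbol x^{\sigma_x}\boldsymbol y^{\sigma_y}\boldsymbol z^{\sigma_z}$. $V_{\mathcal P}(\cdot)$ denotes the set of common zeros in $\mathcal P$. Let $\boldsymbol u=\{u_{i,\sigma}:0\le i\le n,\ \sigma\in\mathcal A(\boldsymbol d_i)\}$ be variables. For $P\in\mathbb K[\boldsymbol u]$ and $\boldsymbol{f_0}\in S(\boldsymbol d_0)\times\dots\times S(\boldsymbol d_n)$, $P(\boldsymbol{f_0})$ is the value of $P$ when each $u_{i,\sigma}$ is replaced by the coefficient of $\boldsymbol w^\sigma$ in $f_i$; for matrices this is done entrywise. The resultant $\mathrm{Res}_{\mathcal P}(\boldsymbol d_0,\dots,\boldsymbol d_n)\in\mathbb Z[\boldsymbol u]$ is the irreducible polynomial (unique up to sign) such that for all $\boldsymbol{f_0}\in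 S(\boldsymbol d_0)\times\dots\times S(\boldsymbol d_n)$: $V_{\mathcal P}(f_0,\dots,f_n)\neq\emptyset$ if and only if $\mathrm{Res}_{\mathcal P}(\boldsymbol d_0,\dots,\boldsymbol d_n)(\boldsymbol{f_0})=0$ (the multidegrees are such that this polynomial exists). Property $\Pi_\theta(\boldsymbol d_0,\dots,\boldsymbol d_n)$: for $\theta\in\mathcal A(\boldsymbol d_0)$, a square block matrix $M=\begin{bmatrix} M_{1,1} & M_{1,2} \\ M_{2,1} & M_{2,2} \end{bmatrix}$ over $\mathbb K[\boldsymbol u]$ has this property when (i) $\mathrm{Res}_{\mathcal P}(\boldsymbol d_0,\dots,\boldsymbol d_n)$ divides $\det(M)$; (ii) $M_{2,2}$ is square and all its diagonal entries are equal to $u_{0,\theta}$; (iii) $u_{0,\theta}$ does not appear anywhere in $M$ except on the diagonal of $M_{2,2}$. *)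

theory Defs
  imports
    "HOL-Library.Poly_Mapping"
    "HOL-Computational_Algebra.Polynomial"
    "Jordan_Normal_Form.Gauss_Jordan_Elimination"
    "Jordan_Normal_Form.Char_Poly"
begin

section \<open>Multivariate polynomials\<close>

type_synonym 'v monomial = "'v \<Rightarrow>\<^sub>0 nat"

type_synonym ('v, 'a) mpolyn = "'v monomial \<Rightarrow>\<^sub>0 'a"

definition mvars :: "('v, 'a::zero) mpolyn \<Rightarrow> 'v set" where
  "mvars P = (\<Union>m\<in>Poly_Mapping.keys P. Poly_Mapping.keys m)"

definition meval :: "('v \<Rightarrow> 'a) \<Rightarrow> ('v, 'a::comm_semiring_1) mpolyn \<Rightarrow> 'a" where
  "meval w P = (\<Sum>m\<in>Poly_Mapping.keys P. Poly_Mapping.lookup P m *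
     (\<Prod>v\<in>Poly_Mapping.keys m. w v ^ Poly_Mapping.lookup m v))"

text \<open>The subring of polynomials in the variables \<open>V\<close>. For \<open>P\<close> in this subring, divisors
  of a nonzero \<open>P\<close> over a domain lie in it too, so \<open>irreducible\<close> and \<open>dvd\<close> mean the same in
  the subring and in the full type.\<close>

definition mpolys_in :: "'v set \<Rightarrow> ('v, 'a::zero) mpolyn set" where
  "mpolys_in V = {P. mvars P \<subseteq> V}"

section \<open>Multihomogeneous polynomials in three blocks of variables\<close>

datatype block = BX | BY | BZ

text \<open>A map \<open>N\<close> from blocks to naturals encodes \<open>(n\<^sub>x, n\<^sub>y, n\<^sub>z)\<close>; likewise a multidegree is a
  map from blocks to naturals. The homogeneous coordinates of block \<open>b\<close> are
  \<open>(b, 0), \<dots>, (b, N b)\<close>.\<close>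

type_synonym hvar = "block \<times> nat"

definition total_dim :: "(block \<Rightarrow> nat) \<Rightarrow> nat" where
  "total_dim N = N BX + N BY + N BZ"

definition coords :: "(block \<Rightarrow> nat) \<Rightarrow> hvar set" where
  "coords N = {(b, j). j \<le> N b}"

definition exponents :: "(block \<Rightarrow> nat) \<Rightarrow> (block \<Rightarrow> nat) \<Rightarrow> hvar monomial set" where
  "exponents N d = {\<sigma>. Poly_Mapping.keys \<sigma> \<subseteq> coords N \<and>
     (\<forall>b. (\<Sum>j\<le>N b. Poly_Mapping.lookup \<sigma> (b, j)) = d b)}"

definition multihom :: "(block \<Rightarrow> nat) \<Rightarrow> (block \<Rightarrow> nat) \<Rightarrow> (hvar, 'k::zero) mpolyn set" where
  "multihom N d = {f. Poly_Mapping.keys f \<subseteq> exponents N d}"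

definition wmonom :: "hvar monomial \<Rightarrow> (hvar, 'k::zero_neq_one) mpolyn" where
  "wmonom \<sigma> = Poly_Mapping.single \<sigma> 1"

section \<open>The product of projective spaces\<close>

definition scaling_rel :: "((nat \<Rightarrow> 'k::field) \<times> (nat \<Rightarrow> 'k)) set" where
  "scaling_rel = {(v, w). \<exists>c. c \<noteq> 0 \<and> w = (\<lambda>j. c * v j)}"

text \<open>Vectors of length \<open>m + 1\<close> are functions vanishing beyond \<open>m\<close>.\<close>

definition proj_space :: "nat \<Rightarrow> (nat \<Rightarrow> 'k::field) set set" where
  "proj_space m = {v. v \<noteq> (\<lambda>j. 0) \<and> (\<forall>j>m. v j = 0)} // scaling_rel"

type_synonym 'k mpoint = "block \<Rightarrow> (nat \<Rightarrow> 'k) set"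

definition multiproj :: "(block \<Rightarrow> nat) \<Rightarrow> 'k::field mpoint set" where
  "multiproj N = {\<alpha>. \<forall>b. \<alpha> b \<in> proj_space (N b)}"

text \<open>The systems of homogeneous coordinates of a point.\<close>

definition reps :: "'k mpoint \<Rightarrow> (hvar \<Rightarrow> 'k) set" where
  "reps \<alpha> = {w. \<forall>b. (\<lambda>j. w (b, j)) \<in> \<alpha> b}"

definition vanishes_at :: "(hvar, 'k::field) mpolyn \<Rightarrow> 'k mpoint \<Rightarrow> bool" where
  "vanishes_at f \<alpha> \<longleftrightarrow> (\<forall>w\<in>reps \<alpha>. meval w f = 0)"

definition proj_zeros :: "(block \<Rightarrow> nat) \<Rightarrow> (hvar, 'k::field) mpolyn set \<Rightarrow> 'k mpoint set" where
  "proj_zeros N F = {\<alpha> \<in> multiproj N. \<forall>f\<in>F. vanishes_at f \<alpha>}"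

text \<open>The value of the rational function \<open>f / g\<close> at a point, for \<open>f\<close>, \<open>g\<close> of equal multidegree
  and \<open>g\<close> not vanishing there; see \<open>quot_value_eq\<close> below.\<close>

definition quot_value :: "(hvar, 'k::field) mpolyn \<Rightarrow> (hvar, 'k) mpolyn \<Rightarrow> 'k mpoint \<Rightarrow> 'k" where
  "quot_value f g \<alpha> = (THE c. \<forall>w\<in>reps \<alpha>. meval w f / meval w g = c)"

lemma UNIV_block: "UNIV = {BX, BY, BZ}"
  using block.exhaust by auto

instance block :: finite
  by standard (simp add: UNIV_block)

lemma coords_Sigma: "coords N = Sigma UNIV (\<lambda>b. {..N b})"
  by (auto simp: coords_def)

lemma meval_rescale:
  fixes f :: "(hvar, 'k::field) mpolyn"
  assumes f: "f \<in> multihom N d" and w': "\<And>b j. w' (b, j) = c b * w (b, j)"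
  shows "meval w' f = (\<Prod>b\<in>UNIV. c b ^ d b) * meval w f"
proof -
  have "(\<Prod>v\<in>Poly_Mapping.keys m. w' v ^ Poly_Mapping.lookup m v) =
     (\<Prod>b\<in>UNIV. c b ^ d b) * (\<Prod>v\<in>Poly_Mapping.keys m. w v ^ Poly_Mapping.lookup m v)"
    if m: "m \<in> Poly_Mapping.keys f" for m
  proof -
    have k: "Poly_Mapping.keys m \<subseteq> coords N"
      and s: "\<And>b. (\<Sum>j\<le>N b. Poly_Mapping.lookup m (b, j)) = d b"
      using f m by (auto simp: multihom_def exponents_def)
    have fin: "finite (coords N)" by (simp add: coords_Sigma)
    have "(\<Prod>v\<in>Poly_Mapping.keys m. c (fst v) ^ Poly_Mapping.lookup m v) =
        (\<Prod>v\<in>coords N. c (fst v) ^ Poly_Mapping.lookup m v)"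
      by (rule prod.mono_neutral_left[OF fin k]) (auto simp: in_keys_iff)
    also have "\<dots> = (\<Prod>b\<in>UNIV. \<Prod>j\<le>N b. c b ^ Poly_Mapping.lookup m (b, j))"
      unfolding coords_Sigma by (subst prod.Sigma) (auto intro!: prod.cong)
    also have "\<dots> = (\<Prod>b\<in>UNIV. c b ^ d b)"
      by (simp add: power_sum[symmetric] s)
    finally have e: "(\<Prod>v\<in>Poly_Mapping.keys m. c (fst v) ^ Poly_Mapping.lookup m v) =
        (\<Prod>b\<in>UNIV. c b ^ d b)" .
    have "w' v = c (fst v) * w v" for v using w'[of "fst v" "snd v"] by simp
    then show ?thesis by (simp add: power_mult_distrib prod.distrib e)
  qed
  then show ?thesis
    unfolding meval_def by (auto simp: sum_distrib_left mult_ac intro!: sum.cong)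
qed

lemma proj_space_classE:
  assumes "A \<in> proj_space m"
  obtains v where "v \<in> A" "v \<noteq> (\<lambda>j. 0)" "A = scaling_rel `` {v}"
proof -
  from assms obtain v where v: "v \<noteq> (\<lambda>j. 0)" "A = scaling_rel `` {v}"
    unfolding proj_space_def quotient_def by auto
  have "(v, v) \<in> scaling_rel" unfolding scaling_rel_def by (auto intro: exI[of _ 1])
  with v that show ?thesis by blast
qed

lemma reps_nonempty:
  assumes "\<alpha> \<in> multiproj N"
  shows "reps \<alpha> \<noteq> {}"
proof -
  have "\<exists>v. v \<in> \<alpha> b" for b
  proof -
    have "\<alpha> b \<in> proj_space (N b)" using assms by (simp add: multiproj_def)
    then show ?thesis by (rule proj_space_classE) blast
  qed
  then obtain V where "\<And>b. V b \<in> \<alpha> b" by metis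
  then have "(\<lambda>(b, j). V b j) \<in> reps \<alpha>" by (simp add: reps_def)
  then show ?thesis by blast
qed

lemma reps_scaled:
  assumes "\<alpha> \<in> multiproj N" and w: "w \<in> reps \<alpha>" and w': "w' \<in> reps \<alpha>"
  shows "\<exists>c. (\<forall>b. c b \<noteq> 0) \<and> (\<forall>b j. w' (b, j) = c b * w (b, j))"
proof -
  have "\<exists>c. c \<noteq> 0 \<and> (\<forall>j. w' (b, j) = c * w (b, j))" for b
  proof -
    have "\<alpha> b \<in> proj_space (N b)" using assms by (simp add: multiproj_def)
    then obtain v where v: "\<alpha> b = scaling_rel `` {v}" by (rule proj_space_classE)
    have "(v, \<lambda>j. w (b, j)) \<in> scaling_rel" "(v, \<lambda>j. w' (b, j)) \<in> scaling_rel"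
      using w w' v unfolding reps_def by auto
    then obtain c1 c2 where c: "c1 \<noteq> 0" "(\<lambda>j. w (b, j)) = (\<lambda>j. c1 * v j)"
        "c2 \<noteq> 0" "(\<lambda>j. w' (b, j)) = (\<lambda>j. c2 * v j)"
      unfolding scaling_rel_def by blast
    have "w (b, j) = c1 * v j" "w' (b, j) = c2 * v j" for j
      using fun_cong[OF c(2), of j] fun_cong[OF c(4), of j] by simp_all
    with c(1,3) show ?thesis by (intro exI[of _ "c2 / c1"]) simp
  qed
  then obtain c where "\<forall>b. c b \<noteq> 0 \<and> (\<forall>j. w' (b, j) = c b * w (b, j))"
    by metis
  then show ?thesis by blast
qed

lemma vanishes_at_iff:
  assumes "\<alpha> \<in> multiproj N" "f \<in> multihom N d" "w \<in> reps \<alpha>"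
  shows "vanishes_at f \<alpha> \<longleftrightarrow> meval w f = 0"
  unfolding vanishes_at_def
proof (rule iffI[rotated])
  assume z: "meval w f = 0"
  show "\<forall>w'\<in>reps \<alpha>. meval w' f = 0"
  proof
    fix w' assume w': "w' \<in> reps \<alpha>"
    obtain c where c: "\<And>b. c b \<noteq> 0" "\<And>b j. w' (b, j) = c b * w (b, j)"
      using reps_scaled[OF assms(1,3) w'] by auto
    show "meval w' f = 0"
      unfolding meval_rescale[OF assms(2), of w' c w, OF c(2)] by (simp add: z)
  qed
qed (use assms in blast)

lemma quot_value_eq:
  assumes \<alpha>: "\<alpha> \<in> multiproj N" and f: "f \<in> multihom N d" and g: "g \<in> multihom N d"
    and w: "w \<in> reps \<alpha>"
  shows "quot_value f g \<alpha> = meval w f / meval w g"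
proof -
  have *: "meval w' f / meval w' g = meval w f / meval w g" if w': "w' \<in> reps \<alpha>" for w'
  proof -
    obtain c where c: "\<And>b. c b \<noteq> 0" "\<And>b j. w' (b, j) = c b * w (b, j)"
      using reps_scaled[OF \<alpha> w w'] by auto
    have "(\<Prod>b\<in>UNIV. c b ^ d b) \<noteq> 0" using c(1) by simp
    then show ?thesis
      unfolding meval_rescale[OF f, of w' c w, OF c(2)] meval_rescale[OF g, of w' c w, OF c(2)]
      by (rule mult_divide_mult_cancel_left)
  qed
  show ?thesis
    unfolding quot_value_def
  proof (rule the_equality)
    show "\<forall>w'\<in>reps \<alpha>. meval w' f / meval w' g = meval w f / meval w g"
      using * by blast
  next
    fix c assume "\<forall>w'\<in>reps \<alpha>. meval w' f / meval w' g = c"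
    from bspec[OF this w] show "c = meval w f / meval w g" by (rule sym)
  qed
qed

section \<open>Generic coefficients, resultant and the property \<open>\<Pi>\<^sub>\<theta>\<close>\<close>

text \<open>The variable \<open>u\<^sub>i\<^sub>,\<^sub>\<sigma>\<close> is the pair \<open>(i, \<sigma>)\<close>.\<close>

type_synonym uvar = "nat \<times> hvar monomial"

definition uvars :: "(block \<Rightarrow> nat) \<Rightarrow> (nat \<Rightarrow> block \<Rightarrow> nat) \<Rightarrow> uvar set" where
  "uvars N d = {(i, \<sigma>). i \<le> total_dim N \<and> \<sigma> \<in> exponents N (d i)}"

definition is_system ::
  "(block \<Rightarrow> nat) \<Rightarrow> (nat \<Rightarrow> block \<Rightarrow> nat) \<Rightarrow> (nat \<Rightarrow> (hvar, 'k::zero) mpolyn) \<Rightarrow> bool" where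
  "is_system N d f \<longleftrightarrow> (\<forall>i\<le>total_dim N. f i \<in> multihom N (d i))"

definition specialize ::
  "(nat \<Rightarrow> (hvar, 'k::comm_semiring_1) mpolyn) \<Rightarrow> (uvar, 'k) mpolyn \<Rightarrow> 'k" where
  "specialize f P = meval (\<lambda>(i, \<sigma>). Poly_Mapping.lookup (f i) \<sigma>) P"

text \<open>The image in \<open>K[u]\<close> of a polynomial with integer coefficients.\<close>

definition of_int_mpoly :: "('v, int) mpolyn \<Rightarrow> ('v, 'k::ring_1) mpolyn" where
  "of_int_mpoly R = Poly_Mapping.map of_int R"

text \<open>The resultant is determined only up to sign (and need not exist for all multidegrees),
  hence a predicate. The base field enters through the type argument.\<close>

definition is_resultant ::
  "'k::field itself \<Rightarrow> (block \<Rightarrow> nat) \<Rightarrow> (nat \<Rightarrow> block \<Rightarrow> nat) \<Rightarrow> (uvar, int) mpolyn \<Rightarrow> bool" where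
  "is_resultant (_ :: 'k itself) N d R \<longleftrightarrow>
     R \<in> mpolys_in (uvars N d) \<and> irreducible R \<and>
     (\<forall>f :: nat \<Rightarrow> (hvar, 'k) mpolyn. is_system N d f \<longrightarrow>
        (proj_zeros N (f ` {0..total_dim N}) \<noteq> {} \<longleftrightarrow> specialize f (of_int_mpoly R) = 0))"

text \<open>\<open>R\<close> is the resultant. The four blocks have sizes \<open>p \<times> p\<close>, \<open>p \<times> q\<close>, \<open>q \<times> p\<close> and \<open>q \<times> q\<close>:
  the whole matrix and \<open>M22\<close> being square, so is \<open>M11\<close>.\<close>

definition property_Pi ::
  "(block \<Rightarrow> nat) \<Rightarrow> (nat \<Rightarrow> block \<Rightarrow> nat) \<Rightarrow> (uvar, int) mpolyn \<Rightarrow> hvar monomial \<Rightarrow>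
   (uvar, 'k::field) mpolyn mat \<Rightarrow> (uvar, 'k) mpolyn mat \<Rightarrow>
   (uvar, 'k) mpolyn mat \<Rightarrow> (uvar, 'k) mpolyn mat \<Rightarrow> bool" where
  "property_Pi N d R \<theta> M11 M12 M21 M22 \<longleftrightarrow>
     (\<exists>p q. M11 \<in> carrier_mat p p \<and> M12 \<in> carrier_mat p q \<and>
        M21 \<in> carrier_mat q p \<and> M22 \<in> carrier_mat q q) \<and>
     elements_mat (four_block_mat M11 M12 M21 M22) \<subseteq> mpolys_in (uvars N d) \<and>
     of_int_mpoly R dvd det (four_block_mat M11 M12 M21 M22) \<and>
     (\<forall>i<dim_row M22. M22 $$ (i, i) =
        Poly_Mapping.single (Poly_Mapping.single (0, \<theta>) 1) 1) \<and>
     (\<forall>P \<in> elements_mat M11 \<union> elements_mat M12 \<union> elements_mat M21. (0, \<theta>) \<notin> mvars P) \<and>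
     (\<forall>i<dim_row M22. \<forall>j<dim_col M22. i \<noteq> j \<longrightarrow> (0, \<theta>) \<notin> mvars (M22 $$ (i, j)))"

end

theory Submission
  imports Defs
begin

text \<open>With \<open>c = (f\<^sub>0 / w\<^sup>\<theta>)(\<alpha>)\<close>, replace \<open>f\<^sub>0\<close> by \<open>g\<^sub>0 = f\<^sub>0 - c w\<^sup>\<theta>\<close>. The new system vanishes at
  \<open>\<alpha>\<close>, so its resultant, and hence the determinant of the specialized matrix, is zero. Only the
  coefficient \<open>u\<^sub>0\<^sub>,\<^sub>\<theta>\<close> has changed, so the specialized matrix differs from the original one just by
  \<open>M\<^sub>2\<^sub>2\<close> becoming \<open>M\<^sub>2\<^sub>2 - c I\<close>. By Schur's formula its determinant is the product of the nonzero
  \<open>det M\<^sub>1\<^sub>1\<close> and the determinant of the Schur complement minus \<open>c I\<close>.\<close>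

lemma sum_single_lookup: "(\<Sum>m\<in>Poly_Mapping.keys P. Poly_Mapping.single m (Poly_Mapping.lookup P m)) = P"
  by (rule poly_mapping_eqI) (auto simp: lookup_sum lookup_single when_def in_keys_iff)

text \<open>The inner product of \<open>meval\<close> gets a name so that its multiplicativity can
  be shown separately and then carried over to polynomials.\<close>

definition monom_val :: "('v \<Rightarrow> 'a::comm_semiring_1) \<Rightarrow> 'v monomial \<Rightarrow> 'a" where
  "monom_val w m = (\<Prod>v\<in>Poly_Mapping.keys m. w v ^ Poly_Mapping.lookup m v)"

text \<open>Exponents off the support are 0 and contribute factors 1, so monomials with different
  supports can be compared over one index set.\<close>

lemma monom_val_superset:
  assumes "finite A" "Poly_Mapping.keys m \<subseteq> A"
  shows "monom_val w m = (\<Prod>v\<in>A. w v ^ Poly_Mapping.lookup m v)"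
  unfolding monom_val_def by (rule prod.mono_neutral_left) (use assms in \<open>auto simp: in_keys_iff\<close>)

lemma monom_val_0 [simp]: "monom_val w 0 = 1"
  by (simp add: monom_val_def)

lemma monom_val_add: "monom_val w (m + n) = monom_val w m * monom_val w n"
proof -
  let ?A = "Poly_Mapping.keys m \<union> Poly_Mapping.keys n"
  have "monom_val w k = (\<Prod>v\<in>?A. w v ^ Poly_Mapping.lookup k v)"
    if "Poly_Mapping.keys k \<subseteq> ?A" for k
    using that by (intro monom_val_superset) auto
  then show ?thesis
    using keys_add[of m n] by (simp add: lookup_add power_add prod.distrib)
qed

text \<open>Monomials off the support have coefficient 0. A common index set is what
  \<open>meval_add\<close> uses, since cancellation may make the support of a sum smaller than the
  union.\<close>

lemma meval_superset:
  assumes "finite A" "Poly_Mapping.keys P \<subseteq> A"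
  shows "meval w P = (\<Sum>m\<in>A. Poly_Mapping.lookup P m * monom_val w m)"
  unfolding meval_def monom_val_def
  by (rule sum.mono_neutral_left) (use assms in \<open>auto simp: in_keys_iff\<close>)

lemma meval_0 [simp]: "meval w 0 = 0"
  by (simp add: meval_def)

lemma meval_add: "meval w (P + Q) = meval w P + meval w Q"
proof -
  let ?A = "Poly_Mapping.keys P \<union> Poly_Mapping.keys Q"
  have "meval w T = (\<Sum>m\<in>?A. Poly_Mapping.lookup T m * monom_val w m)"
    if "Poly_Mapping.keys T \<subseteq> ?A" for T
    using that by (intro meval_superset) auto
  then show ?thesis
    using keys_add[of P Q] by (simp add: lookup_add distrib_right sum.distrib)
qed

lemma meval_sum: "meval w (sum P A) = (\<Sum>i\<in>A. meval w (P i))"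
  by (induction A rule: infinite_finite_induct) (auto simp: meval_add)

lemma meval_single: "meval w (Poly_Mapping.single m a) = a * monom_val w m"
  by (simp add: meval_def monom_val_def)

text \<open>Both factors are expanded into monomials. On these the claim is
  \<open>monom_val_add\<close>, and the double sum factors again.\<close>

lemma meval_mult: "meval w (P * Q) = meval w P * meval w Q"
proof -
  have "P * Q = (\<Sum>m\<in>Poly_Mapping.keys P. \<Sum>n\<in>Poly_Mapping.keys Q.
      Poly_Mapping.single (m + n) (Poly_Mapping.lookup P m * Poly_Mapping.lookup Q n))"
    by (subst (1) sum_single_lookup[of P, symmetric], subst (1) sum_single_lookup[of Q, symmetric])
      (simp add: sum_product mult_single)
  then have "meval w (P * Q) = (\<Sum>m\<in>Poly_Mapping.keys P. \<Sum>n\<in>Poly_Mapping.keys Q.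
      (Poly_Mapping.lookup P m * Poly_Mapping.lookup Q n) * (monom_val w m * monom_val w n))"
    by (simp add: meval_sum meval_single monom_val_add)
  also have "\<dots> = meval w P * meval w Q"
    by (simp add: meval_def monom_val_def[symmetric] sum_product mult_ac)
  finally show ?thesis .
qed

lemma comm_ring_hom_meval: "comm_ring_hom (meval (w :: 'v \<Rightarrow> 'a::comm_ring_1))"
proof
  show "meval w 1 = 1"
    by (simp flip: single_one add: meval_single)
qed (simp_all add: meval_add meval_mult)

lemma comm_ring_hom_specialize:
  "comm_ring_hom (specialize (f :: nat \<Rightarrow> (hvar, 'a::comm_ring_1) mpolyn))"
  unfolding specialize_def[abs_def] by (rule comm_ring_hom_meval)

lemma specialize_uvar:
  "specialize f (Poly_Mapping.single (Poly_Mapping.single (i, \<sigma>) 1) 1) = Poly_Mapping.lookup (f i) \<sigma>"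
  by (simp add: specialize_def meval_single monom_val_def)

text \<open>Allows one coefficient of a system to be changed without affecting the entries in which
  the corresponding variable does not occur.\<close>

lemma specialize_cong:
  assumes "\<And>i \<sigma>. (i, \<sigma>) \<in> mvars P \<Longrightarrow> Poly_Mapping.lookup (f i) \<sigma> = Poly_Mapping.lookup (g i) \<sigma>"
  shows "specialize f P = specialize g P"
proof -
  have "(case v of (i, \<sigma>) \<Rightarrow> Poly_Mapping.lookup (f i) \<sigma>) =
      (case v of (i, \<sigma>) \<Rightarrow> Poly_Mapping.lookup (g i) \<sigma>)"
    if "m \<in> Poly_Mapping.keys P" "v \<in> Poly_Mapping.keys m" for m v
    using that assms by (force simp: mvars_def split: prod.split)
  then show ?thesis
    unfolding specialize_def meval_def by (intro sum.cong arg_cong2[of _ _ _ _ "(*)"] prod.cong) auto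
qed

text \<open>\<open>mat_inverse\<close> returns \<open>None\<close> only for non-units of the matrix
  ring, so for an invertible matrix \<open>the\<close> picks a genuine inverse.\<close>

lemma invertible_mat_the_inverse:
  fixes A :: "'a::field mat"
  assumes A: "A \<in> carrier_mat n n" and inv: "invertible_mat A"
  shows "the (mat_inverse A) \<in> carrier_mat n n" "A * the (mat_inverse A) = 1\<^sub>m n"
proof -
  obtain B where AB: "A * B = 1\<^sub>m n" and BA: "B * A = 1\<^sub>m (dim_row B)"
    using inv A by (auto simp: invertible_mat_def inverts_mat_def)
  \<comment> \<open>Invertibility does not fix the shape of \<open>B\<close>: the first product
    gives its number of columns, the second its number of rows.\<close>
  from arg_cong[OF AB, of dim_col] arg_cong[OF BA, of dim_col] A
  have B: "B \<in> carrier_mat n n"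
    by (intro carrier_matI) auto
  then have "A \<in> Units (ring_mat TYPE('a) n ())"
    using A AB BA by (auto simp: Units_def ring_mat_def)
  then obtain C where C: "mat_inverse A = Some C"
    using mat_inverse(1)[OF A, of "()"] by (cases "mat_inverse A") auto
  from mat_inverse(2)[OF A C] C
  show "the (mat_inverse A) \<in> carrier_mat n n" "A * the (mat_inverse A) = 1\<^sub>m n"
    by auto
qed

text \<open>Block elimination: a column operation of determinant 1 clears the upper right block and
  leaves the Schur complement in the lower right one.\<close>

lemma det_schur_complement:
  fixes A :: "'a::idom mat"
  assumes [simp]: "A \<in> carrier_mat p p" "B \<in> carrier_mat p q" "C \<in> carrier_mat q p"
      "D \<in> carrier_mat q q" "A' \<in> carrier_mat p p"
    and AA': "A * A' = 1\<^sub>m p"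
  shows "det (four_block_mat A B C D) = det A * det (D - C * A' * B)"
proof -
  \<comment> \<open>Right multiplication by \<open>?E\<close> adds to the second block column the
    first one times \<open>- (A' * B)\<close>. Being unitriangular, \<open>?E\<close> has
    determinant 1.\<close>
  let ?E = "four_block_mat (1\<^sub>m p) (- (A' * B)) (0\<^sub>m q p) (1\<^sub>m q)"
  have [simp]: "dim_row A = p" "dim_col A = p" "dim_row A' = p" "dim_col A' = p" "dim_row B = p"
    "dim_col B = q" "dim_row C = q" "dim_col C = p" "dim_row D = q" "dim_col D = q"
    using assms(1-5)[THEN carrier_matD(1)] assms(1-5)[THEN carrier_matD(2)] by simp_all
  have [simp]: "A' * B \<in> carrier_mat p q" "- (A' * B) \<in> carrier_mat p q"
    "C * A' * B \<in> carrier_mat q q"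
    by (auto intro!: mult_carrier_mat[of _ _ p])
  have 1: "A * (A' * B) = B"
    using AA' by (subst assoc_mult_mat[of A p p A' p B q, symmetric])
      (auto simp: left_mult_one_mat[of B p q])
  have 2: "A * (- (A' * B)) + B = 0\<^sub>m p q"
    using 1 by (subst uminus_mult_right_mat) (auto simp: uminus_l_inv_mat)
  have 3: "C * (- (A' * B)) + D = D - C * A' * B"
    by (subst uminus_mult_right_mat)
      (auto simp: assoc_mult_mat[of C q p A' p B q] intro!: eq_matI)
  have "four_block_mat A B C D * ?E = four_block_mat A (0\<^sub>m p q) C (D - C * A' * B)"
    by (subst mult_four_block_mat[where ?n1.0 = p and ?n2.0 = q]) (auto simp: 2 3 simp del: uminus_mult_right_mat)
  moreover have "det (four_block_mat A (0\<^sub>m p q) C (D - C * A' * B)) = det A * det (D - C * A' * B)"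
    by (rule det_four_block_mat_upper_right_zero) (auto intro: minus_carrier_mat)
  moreover have "det ?E = 1"
    by (subst det_four_block_mat_lower_left_zero) auto
  moreover have "det (four_block_mat A B C D * ?E) = det (four_block_mat A B C D) * det ?E"
    by (rule det_mult[where n = "p + q"]) auto
  ultimately show ?thesis by simp
qed

theorem theorem4p2:
  fixes N :: "block \<Rightarrow> nat"
    and d :: "nat \<Rightarrow> block \<Rightarrow> nat"
    and R :: "(uvar, int) mpolyn"
    and \<theta> :: "hvar monomial"
    and M11 M12 M21 M22 :: "(uvar, 'k::{alg_closed_field, field_char_0}) mpolyn mat"
    and f :: "nat \<Rightarrow> (hvar, 'k) mpolyn"
    and \<alpha> :: "'k mpoint"
  assumes "\<forall>b. N b \<ge> 1"
    and "is_resultant TYPE('k) N d R"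
    and "\<theta> \<in> exponents N (d 0)"
    and "property_Pi N d R \<theta> M11 M12 M21 M22"
    and "is_system N d f"
    and "invertible_mat (map_mat (specialize f) M11)"
    and "\<alpha> \<in> proj_zeros N (f ` {1..total_dim N})"
    and "\<not> vanishes_at (wmonom \<theta>) \<alpha>"
  shows "eigenvalue
    (map_mat (specialize f) M22 -
       map_mat (specialize f) M21 * the (mat_inverse (map_mat (specialize f) M11)) *
       map_mat (specialize f) M12)
    (quot_value (f 0) (wmonom \<theta>) \<alpha>)"
proof -
  define c where "c = quot_value (f 0) (wmonom \<theta>) \<alpha>"
  define g where "g = f(0 := f 0 - Poly_Mapping.single \<theta> c)"
  have \<alpha>: "\<alpha> \<in> multiproj N"
    and van: "\<And>i. 1 \<le> i \<Longrightarrow> i \<le> total_dim N \<Longrightarrow> vanishes_at (f i) \<alpha>"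
    using assms(7) by (auto simp: proj_zeros_def)
  have mono: "Poly_Mapping.single \<theta> a \<in> multihom N (d 0)" for a :: 'k
    using assms(3) by (auto simp: multihom_def)
  have f0: "f 0 \<in> multihom N (d 0)"
    using assms(5) by (simp add: is_system_def)
  have g0: "g 0 \<in> multihom N (d 0)"
    using f0 mono[of c] keys_diff[of "f 0" "Poly_Mapping.single \<theta> c"]
    by (auto simp: g_def multihom_def)
  have sys: "is_system N d g"
    using assms(5) g0 by (auto simp: is_system_def g_def)
  obtain w where w: "w \<in> reps \<alpha>"
    using reps_nonempty[OF \<alpha>] by blast
  \<comment> \<open>The hypothesis gives a nonzero value at some representative only. As the
    monomial is multihomogeneous, this carries over to the chosen \<open>w\<close>.\<close>
  have nz: "monom_val w \<theta> \<noteq> 0"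
    using assms(8) vanishes_at_iff[OF \<alpha> _ w, of "wmonom \<theta>" "d 0"] mono[of 1]
    by (simp add: wmonom_def meval_single)
  have c: "c = meval w (f 0) / monom_val w \<theta>"
    using quot_value_eq[OF \<alpha> f0 _ w, of "wmonom \<theta>"] mono[of 1]
    by (simp add: c_def wmonom_def meval_single)
  have "f 0 = g 0 + Poly_Mapping.single \<theta> c"
    by (simp add: g_def)
  then have "meval w (f 0) = meval w (g 0) + c * monom_val w \<theta>"
    using meval_add meval_single by metis
  then have "meval w (g 0) = 0"
    using c nz by simp
  then have "vanishes_at (g 0) \<alpha>"
    using vanishes_at_iff[OF \<alpha> g0 w] by simp
  \<comment> \<open>Index 0 is settled by the choice of \<open>c\<close>; the other members of the
    system are unchanged.\<close>
  then have "vanishes_at (g i) \<alpha>" if "i \<le> total_dim N" for i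
    using van[of i] that by (cases "i = 0") (auto simp: g_def)
  then have "\<alpha> \<in> proj_zeros N (g ` {0..total_dim N})"
    using \<alpha> by (auto simp: proj_zeros_def)
  then have res: "specialize g (of_int_mpoly R) = 0"
    using assms(2) sys unfolding is_resultant_def by blast

  obtain p q where M11: "M11 \<in> carrier_mat p p" and M12: "M12 \<in> carrier_mat p q"
    and M21: "M21 \<in> carrier_mat q p" and M22: "M22 \<in> carrier_mat q q"
    and dvd: "of_int_mpoly R dvd det (four_block_mat M11 M12 M21 M22)"
    and diag: "\<And>i. i < q \<Longrightarrow> M22 $$ (i, i) = Poly_Mapping.single (Poly_Mapping.single (0, \<theta>) 1) 1"
    and free: "\<And>P. P \<in> elements_mat M11 \<union> elements_mat M12 \<union> elements_mat M21 \<Longrightarrow> (0, \<theta>) \<notin> mvars P"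
    and off: "\<And>i j. i < q \<Longrightarrow> j < q \<Longrightarrow> i \<noteq> j \<Longrightarrow> (0, \<theta>) \<notin> mvars (M22 $$ (i, j))"
    using assms(4) unfolding property_Pi_def by (auto simp: carrier_matD)
  interpret spec: comm_ring_hom "specialize g"
    by (rule comm_ring_hom_specialize)
  \<comment> \<open>The systems \<open>f\<close> and \<open>g\<close> differ only in the value given
    to the variable \<open>(0, \<theta>)\<close>.\<close>
  have same: "specialize g P = specialize f P" if "(0, \<theta>) \<notin> mvars P" for P
  proof (rule specialize_cong)
    fix i \<sigma> assume "(i, \<sigma>) \<in> mvars P"
    with that have "i \<noteq> 0 \<or> \<sigma> \<noteq> \<theta>" by auto
    then show "Poly_Mapping.lookup (g i) \<sigma> = Poly_Mapping.lookup (f i) \<sigma>"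
      by (auto simp: g_def lookup_minus lookup_single)
  qed
  have entry: "M $$ (i, j) \<in> elements_mat M" if "i < dim_row M" "j < dim_col M"
    for i j and M :: "(uvar, 'k) mpolyn mat"
    using elements_matI[OF carrier_matI[OF refl refl] that refl] .
  have eqs: "map_mat (specialize g) M11 = map_mat (specialize f) M11"
    "map_mat (specialize g) M12 = map_mat (specialize f) M12"
    "map_mat (specialize g) M21 = map_mat (specialize f) M21"
    by (auto intro!: eq_matI same free simp: entry)
  let ?A = "map_mat (specialize f) M11" and ?B = "map_mat (specialize f) M12"
  let ?C = "map_mat (specialize f) M21" and ?D = "map_mat (specialize f) M22"
  let ?S = "?D - ?C * the (mat_inverse ?A) * ?B"
  have ABCD [simp]: "?A \<in> carrier_mat p p" "?B \<in> carrier_mat p q" "?C \<in> carrier_mat q p"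
    "?D \<in> carrier_mat q q" "map_mat (specialize g) M22 \<in> carrier_mat q q"
    using M11 M12 M21 M22 by auto
  note inv = invertible_mat_the_inverse[OF ABCD(1) assms(6)]
  have prod: "?C * the (mat_inverse ?A) * ?B \<in> carrier_mat q q"
    using inv(1) M12 M21 by (auto intro!: mult_carrier_mat)
  then have S: "?S \<in> carrier_mat q q"
    by (rule minus_carrier_mat)
  \<comment> \<open>A diagonal entry of \<open>M22\<close> specializes to the coefficient of
    \<theta>, which drops by \<open>c\<close>; the other entries avoid that variable. Keeping
    \<open>T\<close> arbitrary lets the entrywise comparison treat the matrix product as a single
    block.\<close>
  have shift: "map_mat (specialize g) M22 - T = char_matrix (?D - T) c"
    if T: "T \<in> carrier_mat q q" for T
  proof (rule eq_matI)
    fix i j assume "i < dim_row (char_matrix (?D - T) c)" "j < dim_col (char_matrix (?D - T) c)"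
    then have ij: "i < q" "j < q" using T by (auto simp: char_matrix_def)
    have "specialize g (M22 $$ (i, j)) = specialize f (M22 $$ (i, j)) - (if i = j then c else 0)"
      using ij same[OF off[of i j]] diag[of j]
      by (auto simp: specialize_uvar g_def lookup_minus simp del: One_nat_def)
    then show "(map_mat (specialize g) M22 - T) $$ (i, j) = char_matrix (?D - T) c $$ (i, j)"
      using ij M22 T by (auto simp: char_matrix_def)
  qed (use M22 T in \<open>auto simp: char_matrix_def\<close>)
  \<comment> \<open>Specialization is a ring homomorphism, so it commutes with \<open>det\<close>
    and turns the divisibility by the resultant into the vanishing of the determinant.\<close>
  have "0 = det (map_mat (specialize g) (four_block_mat M11 M12 M21 M22))"
    using dvd res by (auto simp: spec.hom_mult elim!: dvdE)
  also have "\<dots> = det (four_block_mat ?A ?B ?C (map_mat (specialize g) M22))"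
    by (simp add: map_four_block_mat[OF M11 M12 M21 M22] eqs)
  \<comment> \<open>The block \<open>?A\<close> is the same for both systems, so the Schur
    complement for \<open>g\<close> uses the inverse taken for \<open>f\<close>.\<close>
  also have "\<dots> = det ?A * det (char_matrix ?S c)"
    using det_schur_complement[OF ABCD(1-3,5) inv] by (simp only: shift[OF prod])
  finally have "det ?A * det (char_matrix ?S c) = 0" by simp
  moreover have "det ?A \<noteq> 0"
    using det_mult[OF ABCD(1) inv(1)] inv(2) by auto
  ultimately show ?thesis
    using eigenvalue_det[OF S] by (simp add: c_def)
qed

end
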